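(* Let $U\subset V$ be a Lagrangian subspace of a symplectic vector space $(V,\omega)$. Any $\mathrm{Sp}(V)$-orbit in $C(\mathfrak{sp}(V))\subset S^3V$ intersects the subspace $S^3U\subset S^3V$. Moreover $$C(\mathfrak{sp}(V))=\bigcup_U S^3U\subset S^3V,$$ where the union is over all Lagrangian subspaces $U\subset V$.
   Context: $V$ is a finite-dimensional real vector space with nondegenerate alternating form $\omega$. The first prolongation $\mathfrak{sp}(V)^{(1)}=(V^*\otimes\mathfrak{sp}(V))\cap(S^2V^*\otimes V)$, i.e. the space of linear maps $S:V\to\mathfrak{sp}(V)$ with $S_XY=S_YX$, is identified with $S^3V^*$ via $S\mapsto\big((X,Y,Z)\mapsto\omega(S_XY,Z)\big)$, and $S^3V^*$ with $S^3V$ via $V\to V^*$, $v\mapsto\omega(v,\cdot)$. $C(\mathfrak{sp}(V))=\{S\in\mathfrak{sp}(V)^{(1)}\mid[S_X,S_Y]=0,\ \mathrm{tr}\,S_X=0\ \forall X,Y\in V\}$ (the trace condition is automatic), regarded as a subset of $S^3V$. $\mathrm{Sp}(V)$ acts on $S^3V$ by the standard representation. *)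

theory Defs
  imports "HOL-Analysis.Analysis"
begin

section \<open>Linear algebra over a real vector space\<close>

definition finite_dimensional :: "'a::real_vector itself \<Rightarrow> bool" where
  "finite_dimensional _ \<longleftrightarrow> (\<exists>B::'a set. finite B \<and> span B = UNIV)"

text \<open>The trace of an endomorphism; for finite-dimensional \<open>'a\<close> it does not depend on the
  basis chosen.\<close>
definition endo_trace :: "('a::real_vector \<Rightarrow> 'a) \<Rightarrow> real" where
  "endo_trace f =
    (let B = (SOME B. independent B \<and> span B = UNIV) in \<Sum>b\<in>B. representation B (f b) b)"

typedef (overloaded) 'a covector = "{f :: 'a::real_vector \<Rightarrow> real. linear f}"
  morphisms covector_apply Covector
  by (rule exI[of _ "\<lambda>_. 0"]) (simp add: linear_iff)

setup_lifting type_definition_covector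

instantiation covector :: (real_vector) real_vector
begin

lift_definition zero_covector :: "'a covector" is "\<lambda>_. 0"
  by (simp add: linear_iff)
lift_definition plus_covector :: "'a covector \<Rightarrow> 'a covector \<Rightarrow> 'a covector"
  is "\<lambda>f g x. f x + g x"
  by (simp add: linear_iff algebra_simps)
lift_definition minus_covector :: "'a covector \<Rightarrow> 'a covector \<Rightarrow> 'a covector"
  is "\<lambda>f g x. f x - g x"
  by (simp add: linear_iff algebra_simps)
lift_definition uminus_covector :: "'a covector \<Rightarrow> 'a covector" is "\<lambda>f x. - f x"
  by (simp add: linear_iff)
lift_definition scaleR_covector :: "real \<Rightarrow> 'a covector \<Rightarrow> 'a covector"
  is "\<lambda>c f x. c * f x"
  by (simp add: linear_iff algebra_simps)

instance
  by standard (transfer; simp add: algebra_simps fun_eq_iff)+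

end

definition trilinear :: "('a::real_vector \<Rightarrow> 'a \<Rightarrow> 'a \<Rightarrow> 'b::real_vector) \<Rightarrow> bool" where
  "trilinear F \<longleftrightarrow> (\<forall>y z. linear (\<lambda>x. F x y z)) \<and> (\<forall>x z. linear (\<lambda>y. F x y z))
     \<and> (\<forall>x y. linear (\<lambda>z. F x y z))"

definition symmetric3 :: "('a \<Rightarrow> 'a \<Rightarrow> 'a \<Rightarrow> 'b) \<Rightarrow> bool" where
  "symmetric3 F \<longleftrightarrow> (\<forall>x y z. F x y z = F y x z \<and> F x y z = F x z y)"

text \<open>The type \<open>'a cubic_form\<close> is \<open>S\<^sup>3V\<^sup>*\<close> for \<open>V = 'a\<close>: symmetric trilinear forms on \<open>V\<close>.\<close>
typedef (overloaded) 'a cubic_form =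
  "{F :: 'a::real_vector \<Rightarrow> 'a \<Rightarrow> 'a \<Rightarrow> real. trilinear F \<and> symmetric3 F}"
  morphisms cubic_apply Cubic
  by (rule exI[of _ "\<lambda>_ _ _. 0"]) (simp add: trilinear_def symmetric3_def linear_iff)

setup_lifting type_definition_cubic_form

instantiation cubic_form :: (real_vector) real_vector
begin

lift_definition zero_cubic_form :: "'a cubic_form" is "\<lambda>_ _ _. 0"
  by (simp add: trilinear_def symmetric3_def linear_iff)
lift_definition plus_cubic_form :: "'a cubic_form \<Rightarrow> 'a cubic_form \<Rightarrow> 'a cubic_form"
  is "\<lambda>F G x y z. F x y z + G x y z"
  unfolding trilinear_def symmetric3_def linear_iff
  by (simp add: algebra_simps)
lift_definition minus_cubic_form :: "'a cubic_form \<Rightarrow> 'a cubic_form \<Rightarrow> 'a cubic_form"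
  is "\<lambda>F G x y z. F x y z - G x y z"
  unfolding trilinear_def symmetric3_def linear_iff
  by (simp add: algebra_simps)
lift_definition uminus_cubic_form :: "'a cubic_form \<Rightarrow> 'a cubic_form" is "\<lambda>F x y z. - F x y z"
  unfolding trilinear_def symmetric3_def linear_iff
  by (simp add: algebra_simps)
lift_definition scaleR_cubic_form :: "real \<Rightarrow> 'a cubic_form \<Rightarrow> 'a cubic_form"
  is "\<lambda>c F x y z. c * F x y z"
  unfolding trilinear_def symmetric3_def linear_iff
  by (simp add: algebra_simps)

instance
  by standard (transfer; simp add: algebra_simps fun_eq_iff)+

end

text \<open>For finite-dimensional \<open>V\<close>, the symmetric cube \<open>S\<^sup>3V\<close> is the space of symmetric
  trilinear forms on the dual space \<open>V\<^sup>*\<close>.\<close>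
type_synonym 'a sym_cube = "'a covector cubic_form"

text \<open>The product \<open>u v w\<close> in \<open>S\<^sup>3V\<close>, i.e. the symmetrization of \<open>u \<otimes> v \<otimes> w\<close>, as a form
  on \<open>V\<^sup>*\<close>.\<close>
definition sym_prod :: "'a::real_vector \<Rightarrow> 'a \<Rightarrow> 'a \<Rightarrow> 'a sym_cube" where
  "sym_prod u v w = Cubic (\<lambda>\<alpha> \<beta> \<gamma>.
     (let a = covector_apply \<alpha>; b = covector_apply \<beta>; c = covector_apply \<gamma> in
       (a u * b v * c w + a u * b w * c v + a v * b u * c w
        + a v * b w * c u + a w * b u * c v + a w * b v * c u) / 6))"

definition sym_cube_of :: "'a::real_vector set \<Rightarrow> 'a sym_cube set" where
  "sym_cube_of U = span {sym_prod u v w | u v w. u \<in> U \<and> v \<in> U \<and> w \<in> U}"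

definition cubic_pullback ::
    "('a::real_vector \<Rightarrow> 'b::real_vector) \<Rightarrow> 'b cubic_form \<Rightarrow> 'a cubic_form" where
  "cubic_pullback A F = Cubic (\<lambda>x y z. cubic_apply F (A x) (A y) (A z))"

definition transpose_map ::
    "('a::real_vector \<Rightarrow> 'b::real_vector) \<Rightarrow> 'b covector \<Rightarrow> 'a covector" where
  "transpose_map g \<beta> = Covector (\<lambda>x. covector_apply \<beta> (g x))"

text \<open>The standard representation on \<open>S\<^sup>3V\<close>, \<open>u v w \<mapsto> (g u) (g v) (g w)\<close>; see
  \<open>sym_cube_action_prod\<close> below.\<close>
definition sym_cube_action :: "('a::real_vector \<Rightarrow> 'a) \<Rightarrow> 'a sym_cube \<Rightarrow> 'a sym_cube" where
  "sym_cube_action g T = cubic_pullback (transpose_map g) T"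


section \<open>Symplectic vector spaces\<close>

definition symplectic_form :: "('a::real_vector \<Rightarrow> 'a \<Rightarrow> real) \<Rightarrow> bool" where
  "symplectic_form \<omega> \<longleftrightarrow> bilinear \<omega> \<and> (\<forall>x. \<omega> x x = 0) \<and> (\<forall>x. (\<forall>y. \<omega> x y = 0) \<longrightarrow> x = 0)"

definition lagrangian :: "('a::real_vector \<Rightarrow> 'a \<Rightarrow> real) \<Rightarrow> 'a set \<Rightarrow> bool" where
  "lagrangian \<omega> U \<longleftrightarrow> subspace U \<and> U = {v. \<forall>u\<in>U. \<omega> u v = 0}"

definition Sp_group :: "('a::real_vector \<Rightarrow> 'a \<Rightarrow> real) \<Rightarrow> ('a \<Rightarrow> 'a) set" where
  "Sp_group \<omega> = {g. linear g \<and> bij g \<and> (\<forall>x y. \<omega> (g x) (g y) = \<omega> x y)}"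

definition sp_algebra :: "('a::real_vector \<Rightarrow> 'a \<Rightarrow> real) \<Rightarrow> ('a \<Rightarrow> 'a) set" where
  "sp_algebra \<omega> = {A. linear A \<and> (\<forall>x y. \<omega> (A x) y + \<omega> x (A y) = 0)}"

definition Sp_orbit ::
    "('a::real_vector \<Rightarrow> 'a \<Rightarrow> real) \<Rightarrow> 'a sym_cube \<Rightarrow> 'a sym_cube set" where
  "Sp_orbit \<omega> T = {sym_cube_action g T | g. g \<in> Sp_group \<omega>}"

definition first_prolongation :: "('a::real_vector \<Rightarrow> 'a) set \<Rightarrow> ('a \<Rightarrow> 'a \<Rightarrow> 'a) set" where
  "first_prolongation h = {S. bilinear S \<and> (\<forall>X. S X \<in> h) \<and> (\<forall>X Y. S X Y = S Y X)}"

definition commuting_prolongation :: "('a::real_vector \<Rightarrow> 'a) set \<Rightarrow> ('a \<Rightarrow> 'a \<Rightarrow> 'a) set" where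
  "commuting_prolongation h = {S \<in> first_prolongation h.
     (\<forall>X Y Z. S X (S Y Z) - S Y (S X Z) = 0) \<and> (\<forall>X. endo_trace (S X) = 0)}"

text \<open>The identification of the first prolongation of \<open>sp(V)\<close> with \<open>S\<^sup>3V\<^sup>*\<close>.\<close>
definition prolongation_form ::
    "('a::real_vector \<Rightarrow> 'a \<Rightarrow> real) \<Rightarrow> ('a \<Rightarrow> 'a \<Rightarrow> 'a) \<Rightarrow> 'a cubic_form" where
  "prolongation_form \<omega> S = Cubic (\<lambda>X Y Z. \<omega> (S X Y) Z)"

text \<open>The identification of \<open>S\<^sup>3V\<close> with \<open>S\<^sup>3V\<^sup>*\<close> induced by \<open>v \<mapsto> \<omega>(v, \<cdot>)\<close>. As elements of
  \<open>S\<^sup>3V\<close> are forms on \<open>V\<^sup>*\<close>, this is the pullback along the transposed map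
  \<open>X \<mapsto> \<omega>(\<cdot>, X)\<close> from \<open>V\<close> to \<open>V\<^sup>*\<close>; see \<open>sym_cube_flat_prod\<close> below.\<close>
definition sym_cube_flat ::
    "('a::real_vector \<Rightarrow> 'a \<Rightarrow> real) \<Rightarrow> 'a sym_cube \<Rightarrow> 'a cubic_form" where
  "sym_cube_flat \<omega> T = cubic_pullback (\<lambda>X. Covector (\<lambda>v. \<omega> v X)) T"

text \<open>The set \<open>C(sp(V))\<close>, regarded as a subset of \<open>S\<^sup>3V\<close>.\<close>
definition C_sp :: "('a::real_vector \<Rightarrow> 'a \<Rightarrow> real) \<Rightarrow> 'a sym_cube set" where
  "C_sp \<omega> =
    {T. \<exists>S \<in> commuting_prolongation (sp_algebra \<omega>). sym_cube_flat \<omega> T = prolongation_form \<omega> S}"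


section \<open>The representing functions above are in range of the typedef constructors\<close>

lemma linear_covector_apply: "linear (covector_apply \<alpha>)"
  using covector_apply by auto

lemma covector_apply_Covector: "linear f \<Longrightarrow> covector_apply (Covector f) = f"
  by (simp add: Covector_inverse)

lemma cubic_apply_Cubic:
  "trilinear F \<Longrightarrow> symmetric3 F \<Longrightarrow> cubic_apply (Cubic F) = F"
  by (simp add: Cubic_inverse)

lemma cubic_apply_pullback:
  assumes "linear A"
  shows "cubic_apply (cubic_pullback A F) x y z = cubic_apply F (A x) (A y) (A z)"
proof -
  have F: "trilinear (cubic_apply F)" "symmetric3 (cubic_apply F)"
    using cubic_apply[of F] by auto
  have "trilinear (\<lambda>x y z. cubic_apply F (A x) (A y) (A z))"
    using F(1) assms unfolding trilinear_def linear_iff by simp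
  moreover have "symmetric3 (\<lambda>x y z. cubic_apply F (A x) (A y) (A z))"
    using F(2) unfolding symmetric3_def by blast
  ultimately show ?thesis
    unfolding cubic_pullback_def by (simp add: cubic_apply_Cubic)
qed

lemma covector_apply_transpose:
  assumes "linear g"
  shows "covector_apply (transpose_map g \<beta>) x = covector_apply \<beta> (g x)"
proof -
  have "linear (\<lambda>x. covector_apply \<beta> (g x))"
    using linear_compose[OF assms linear_covector_apply] by (simp add: o_def)
  then show ?thesis by (simp add: transpose_map_def covector_apply_Covector)
qed

lemma linear_transpose_map: "linear g \<Longrightarrow> linear (transpose_map g)"
  by (simp add: linear_iff covector_apply_inject[symmetric] fun_eq_iff covector_apply_transpose
      plus_covector.rep_eq scaleR_covector.rep_eq)

lemma cubic_apply_sym_prod: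
  "cubic_apply (sym_prod u v w) \<alpha> \<beta> \<gamma> =
     (let a = covector_apply \<alpha>; b = covector_apply \<beta>; c = covector_apply \<gamma> in
       (a u * b v * c w + a u * b w * c v + a v * b u * c w
        + a v * b w * c u + a w * b u * c v + a w * b v * c u) / 6)"
  unfolding sym_prod_def
  by (subst cubic_apply_Cubic)
    (simp_all add: trilinear_def symmetric3_def linear_iff Let_def plus_covector.rep_eq
      scaleR_covector.rep_eq field_simps)

lemma sym_cube_action_prod:
  assumes "linear g"
  shows "sym_cube_action g (sym_prod u v w) = sym_prod (g u) (g v) (g w)"
  by (simp add: cubic_apply_inject[symmetric] fun_eq_iff sym_cube_action_def Let_def
      cubic_apply_pullback[OF linear_transpose_map[OF assms]] cubic_apply_sym_prod
      covector_apply_transpose[OF assms])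

lemma sym_cube_flat_prod:
  assumes "bilinear \<omega>"
  shows "cubic_apply (sym_cube_flat \<omega> (sym_prod u v w)) X Y Z =
    (\<omega> u X * \<omega> v Y * \<omega> w Z + \<omega> u X * \<omega> w Y * \<omega> v Z + \<omega> v X * \<omega> u Y * \<omega> w Z
     + \<omega> v X * \<omega> w Y * \<omega> u Z + \<omega> w X * \<omega> u Y * \<omega> v Z + \<omega> w X * \<omega> v Y * \<omega> u Z) / 6"
proof -
  have *: "covector_apply (Covector (\<lambda>v. \<omega> v X)) = (\<lambda>v. \<omega> v X)" for X
    using assms by (simp add: bilinear_def covector_apply_Covector)
  have "linear (\<lambda>X. Covector (\<lambda>v. \<omega> v X))"
    unfolding linear_iff covector_apply_inject[symmetric] plus_covector.rep_eq
      scaleR_covector.rep_eq *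
    by (simp add: bilinear_radd[OF assms] bilinear_rmul[OF assms])
  then show ?thesis
    by (simp add: sym_cube_flat_def cubic_apply_pullback cubic_apply_sym_prod * Let_def)
qed

lemma cubic_apply_prolongation_form:
  assumes "symplectic_form \<omega>" "S \<in> first_prolongation (sp_algebra \<omega>)"
  shows "cubic_apply (prolongation_form \<omega> S) X Y Z = \<omega> (S X Y) Z"
proof -
  have w: "bilinear \<omega>" "\<And>x. \<omega> x x = 0"
    using assms(1) by (auto simp: symplectic_form_def)
  have S: "bilinear S" "\<And>X Y. S X Y = S Y X" "\<And>X Y Z. \<omega> (S X Y) Z + \<omega> Y (S X Z) = 0"
    using assms(2) by (auto simp: first_prolongation_def sp_algebra_def)
  have skew: "\<omega> x y = - \<omega> y x" for x y
    using w(2)[of "x + y"] w(2)[of x] w(2)[of y]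
    by (simp add: bilinear_ladd[OF w(1)] bilinear_radd[OF w(1)])
  have "\<omega> (S X Y) Z = \<omega> (S X Z) Y" for X Y Z
    using S(3)[of X Y Z] skew[of Y "S X Z"] by simp
  then have "symmetric3 (\<lambda>X Y Z. \<omega> (S X Y) Z)"
    unfolding symmetric3_def using S(2) by metis
  moreover have "trilinear (\<lambda>X Y Z. \<omega> (S X Y) Z)"
    by (simp add: trilinear_def linear_iff bilinear_ladd[OF w(1)] bilinear_radd[OF w(1)]
        bilinear_lmul[OF w(1)] bilinear_rmul[OF w(1)] bilinear_ladd[OF S(1)]
        bilinear_radd[OF S(1)] bilinear_lmul[OF S(1)] bilinear_rmul[OF S(1)])
  ultimately show ?thesis
    unfolding prolongation_form_def by (simp add: cubic_apply_Cubic)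
qed

end

theory Submission
  imports Defs
begin

text \<open>
  For \<open>S \<in> sp(V)\<^sup>(\<^sup>1\<^sup>)\<close> put \<open>G(X, Z; Y, W) = \<omega>(S\<^sub>X Z, S\<^sub>Y W)\<close>. This is symmetric within each
  pair and skew under exchange of the two pairs, while commutativity of the \<open>S\<^sub>X\<close> is symmetry in
  \<open>X, Y\<close>, hence total symmetry; so \<open>G = 0\<close> and the image of \<open>S\<close> is isotropic. A maximal isotropic
  set \<open>U\<close> containing it is a Lagrangian subspace, and the cubic form of \<open>S\<close> vanishes as soon as
  one argument lies in \<open>U = U\<^sup>\<bottom>\<close>, which means that \<open>S\<close> comes from \<open>S\<^sup>3U\<close>. Conversely
  an element of \<open>S\<^sup>3U\<close> gives \<open>S\<close> with all \<open>S\<^sub>X\<close> mapping \<open>V\<close> into \<open>U\<close> and killing \<open>U\<close>.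
  The statement on orbits follows because \<open>Sp(V)\<close> is transitive on Lagrangian subspaces.
\<close>

section \<open>Traces and finite-dimensional linear algebra\<close>

text \<open>The basis chosen by \<open>SOME\<close> does not depend on the endomorphism, so one
  basis serves all \<open>f\<close> at once, and linearity of the trace can be read off
  coefficientwise.\<close>

lemma endo_trace_basis:
  obtains B :: "'a::real_vector set" where "independent B" "span B = UNIV"
    "\<And>f :: 'a \<Rightarrow> 'a. endo_trace f = (\<Sum>b\<in>B. representation B (f b) b)"
proof -
  define B where "B = (SOME B::'a set. independent B \<and> span B = UNIV)"
  obtain B0 :: "'a set" where "independent B0" "UNIV \<subseteq> span B0"
    using maximal_independent_subset[of UNIV] by metis
  then have "\<exists>B::'a set. independent B \<and> span B = UNIV" by blast
  then have "independent B \<and> span B = UNIV"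
    unfolding B_def by (rule someI_ex)
  then show ?thesis
    by (intro that) (simp_all add: endo_trace_def B_def[symmetric] Let_def)
qed

lemma endo_trace_add: "endo_trace (\<lambda>x. f x + g x) = endo_trace f + endo_trace g"
proof (rule endo_trace_basis)
  fix B :: "'a set"
  assume "independent B" "span B = UNIV"
    "\<And>f :: 'a \<Rightarrow> 'a. endo_trace f = (\<Sum>b\<in>B. representation B (f b) b)"
  then show ?thesis by (simp add: representation_add sum.distrib)
qed

lemma endo_trace_scaleR: "endo_trace (\<lambda>x. c *\<^sub>R f x) = c * endo_trace f"
proof (rule endo_trace_basis)
  fix B :: "'a set"
  assume "independent B" "span B = UNIV"
    "\<And>f :: 'a \<Rightarrow> 'a. endo_trace f = (\<Sum>b\<in>B. representation B (f b) b)"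
  then show ?thesis by (simp add: representation_scale sum_distrib_left)
qed

lemma finite_dimensional_basis:
  fixes E :: "'a::real_vector set"
  assumes "finite_dimensional TYPE('a)" "independent E"
  obtains B where "E \<subseteq> B" "finite B" "independent B" "span B = UNIV"
proof -
  obtain F :: "'a set" where F: "finite F" "span F = UNIV"
    using assms(1) unfolding finite_dimensional_def by blast
  obtain B where B: "E \<subseteq> B" "independent B" "UNIV \<subseteq> span B"
    using maximal_independent_subset_extend[OF subset_UNIV assms(2)] by metis
  have "finite B"
    using independent_span_bound[OF F(1) B(2)] F(2) by blast
  with B that show ?thesis by blast
qed

lemma finite_dimensional_inj_imp_surj:
  fixes f :: "'a::real_vector \<Rightarrow> 'a"
  assumes "finite_dimensional TYPE('a)" "linear f" "inj f"
  shows "surj f"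
proof -
  obtain B :: "'a set" where B: "finite B" "independent B" "span B = UNIV"
    using finite_dimensional_basis[OF assms(1) independent_empty] by metis
  \<comment> \<open>The locale takes a finite basis as a parameter; this is how the
    finite-dimensionality assumption on the type enters.\<close>
  interpret fd: finite_dimensional_vector_space "scaleR :: real \<Rightarrow> 'a \<Rightarrow> 'a" B
    by unfold_locales (use B in \<open>auto simp: algebra_simps dependent_raw_def span_raw_def\<close>)
  show ?thesis
    using fd.linear_inj_imp_surj assms(2,3) by (simp add: linear_def)
qed

text \<open>Writing \<open>w\<close> as the sum of \<open>w_b *\<^sub>R b\<close>, the diagonal
  coefficient of the map at \<open>b\<close> is \<open>g b * w_b\<close>, and these add up to
  \<open>g w\<close>. The traces of the maps \<open>S X\<close> built from products in
  \<open>S\<^sup>3U\<close> reduce to this case.\<close>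

lemma endo_trace_rank_one:
  fixes w :: "'a::real_vector"
  assumes fd: "finite_dimensional TYPE('a)" and g: "linear g"
  shows "endo_trace (\<lambda>x. g x *\<^sub>R w) = g w"
proof (rule endo_trace_basis)
  fix B :: "'a set"
  assume B: "independent B" "span B = UNIV"
    and tr: "\<And>f :: 'a \<Rightarrow> 'a. endo_trace f = (\<Sum>b\<in>B. representation B (f b) b)"
  have fin: "finite B"
    using finite_dimensional_basis[OF fd B(1)] finite_subset by metis
  have "g w = g (\<Sum>b\<in>B. representation B w b *\<^sub>R b)"
    using sum_representation_eq[OF B(1) _ fin order_refl, of w] B(2) by simp
  also have "\<dots> = (\<Sum>b\<in>B. representation B (g b *\<^sub>R w) b)"
    using B by (simp add: linear_sum[OF g] linear_cmul[OF g] representation_scale mult.commute)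
  finally show ?thesis by (simp add: tr)
qed

section \<open>Cubic forms on the dual space and the subspaces \<open>S\<^sup>3U\<close>\<close>

lemma covector_apply_sum: "covector_apply (\<Sum>i\<in>I. f i) x = (\<Sum>i\<in>I. covector_apply (f i) x)"
  by (induction I rule: infinite_finite_induct)
    (auto simp: zero_covector.rep_eq plus_covector.rep_eq)

lemma cubic_apply_sum:
  "cubic_apply (\<Sum>i\<in>I. f i) x y z = (\<Sum>i\<in>I. cubic_apply (f i) x y z)"
  by (induction I rule: infinite_finite_induct)
    (auto simp: zero_cubic_form.rep_eq plus_cubic_form.rep_eq)

lemma cubic_apply_linear1: "linear (\<lambda>x. cubic_apply T x y z)"
  and cubic_apply_swap12: "cubic_apply T x y z = cubic_apply T y x z"
  and cubic_apply_swap23: "cubic_apply T x y z = cubic_apply T x z y"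
  using cubic_apply[of T] by (auto simp: trilinear_def symmetric3_def)

lemma subspace_sym_cube_of: "subspace (sym_cube_of U)"
  unfolding sym_cube_of_def by (rule subspace_span)

lemma sym_prod_in_sym_cube_of:
  "\<lbrakk>u \<in> U; v \<in> U; w \<in> U\<rbrakk> \<Longrightarrow> sym_prod u v w \<in> sym_cube_of U"
  unfolding sym_cube_of_def by (rule span_base) blast

lemma linear_cubic_pullback:
  assumes "linear A" shows "linear (cubic_pullback A)"
  by (simp add: linear_iff cubic_apply_inject[symmetric] fun_eq_iff cubic_apply_pullback[OF assms]
      plus_cubic_form.rep_eq scaleR_cubic_form.rep_eq)

lemma linear_sym_cube_action:
  assumes "linear g" shows "linear (sym_cube_action g)"
  unfolding sym_cube_action_def[abs_def]
  by (rule linear_cubic_pullback[OF linear_transpose_map[OF assms]])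

lemma sym_cube_action_sym_cube_of:
  assumes g: "linear g" "g ` U \<subseteq> U'" and T: "T \<in> sym_cube_of U"
  shows "sym_cube_action g T \<in> sym_cube_of U'"
proof -
  have "sym_cube_action g ` sym_cube_of U
      = span (sym_cube_action g ` {sym_prod u v w | u v w. u \<in> U \<and> v \<in> U \<and> w \<in> U})"
    unfolding sym_cube_of_def by (rule linear_span_image[OF linear_sym_cube_action[OF g(1)], symmetric])
  also have "\<dots> \<subseteq> sym_cube_of U'"
    by (rule span_minimal[OF _ subspace_sym_cube_of])
      (use g(2) in \<open>auto simp: sym_cube_action_prod[OF g(1)] image_subset_iff
        intro!: sym_prod_in_sym_cube_of\<close>)
  finally show ?thesis using T by blast
qed

text \<open>Vanishing on the annihilator of \<open>U\<close> in the first slot gives, by symmetry,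
  vanishing in every slot. So \<open>T\<close> depends only on the restrictions of its arguments to
  \<open>U\<close>, and expanding these in a basis of \<open>U\<close> exhibits \<open>T\<close> as
  a combination of products of basis vectors.\<close>

lemma sym_cube_of_annihilator:
  fixes U :: "'a::real_vector set"
  assumes fd: "finite_dimensional TYPE('a)" and U: "subspace U"
    and T: "\<And>\<alpha> \<beta> \<gamma>. (\<And>u. u \<in> U \<Longrightarrow> covector_apply \<alpha> u = 0) \<Longrightarrow> cubic_apply T \<alpha> \<beta> \<gamma> = 0"
  shows "T \<in> sym_cube_of U"
proof -
  obtain E where E: "E \<subseteq> U" "independent E" "U \<subseteq> span E"
    using maximal_independent_subset[of U] by metis
  obtain B where B: "E \<subseteq> B" "finite B" "independent B" "span B = UNIV"
    using finite_dimensional_basis[OF fd E(2)] .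
  have finE: "finite E" using B finite_subset by blast
  define d where "d b = Covector (\<lambda>v. representation B v b)" for b
  have "linear (\<lambda>v. representation B v b)" for b
    using B by (simp add: linear_iff representation_add representation_scale)
  then have d: "covector_apply (d b) v = representation B v b" for b v
    by (simp add: d_def covector_apply_Covector)
  \<comment> \<open>The projection of covectors onto the span of the \<open>d b\<close> with
    \<open>b \<in> E\<close>, along the annihilator of \<open>U\<close>.\<close>
  define p where "p \<alpha> = (\<Sum>b\<in>E. covector_apply \<alpha> b *\<^sub>R d b)" for \<alpha>
  have agree: "covector_apply \<alpha> u = covector_apply (p \<alpha>) u" if "u \<in> U" for \<alpha> u
  proof (rule linear_eq_on[OF linear_covector_apply linear_covector_apply])
    show "u \<in> span E" using that E by blast
  next
    fix c assume "c \<in> E"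
    then have "covector_apply (p \<alpha>) c = (\<Sum>b\<in>E. covector_apply \<alpha> b * (if c = b then 1 else 0))"
      using B by (auto simp: p_def covector_apply_sum scaleR_covector.rep_eq d
          representation_basis intro!: sum.cong)
    also have "\<dots> = covector_apply \<alpha> c"
      using finE \<open>c \<in> E\<close> by (simp add: if_distrib cong: if_cong)
    finally show "covector_apply \<alpha> c = covector_apply (p \<alpha>) c" by simp
  qed
  have "cubic_apply T (\<alpha> - p \<alpha>) \<beta> \<gamma> = 0" for \<alpha> \<beta> \<gamma>
    by (rule T) (simp add: minus_covector.rep_eq agree[symmetric])
  then have proj: "cubic_apply T \<alpha> \<beta> \<gamma> = cubic_apply T (p \<alpha>) \<beta> \<gamma>" for \<alpha> \<beta> \<gamma>
    by (simp add: linear_diff[OF cubic_apply_linear1])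
  have expand: "cubic_apply T \<alpha> \<beta> \<gamma>
      = (\<Sum>b\<in>E. covector_apply \<alpha> b * cubic_apply T (d b) \<beta> \<gamma>)" for \<alpha> \<beta> \<gamma>
    by (subst proj) (simp add: p_def linear_sum[OF cubic_apply_linear1]
        linear_cmul[OF cubic_apply_linear1])
  let ?t = "\<lambda>b c e. cubic_apply T (d b) (d c) (d e)"
  have full: "cubic_apply T \<alpha> \<beta> \<gamma> = (\<Sum>b\<in>E. \<Sum>c\<in>E. \<Sum>e\<in>E.
      covector_apply \<alpha> b * covector_apply \<beta> c * covector_apply \<gamma> e * ?t b c e)" for \<alpha> \<beta> \<gamma>
  proof -
    have 3: "cubic_apply T (d b) (d c) \<gamma> = (\<Sum>e\<in>E. covector_apply \<gamma> e * ?t b c e)" for b c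
      by (metis (no_types, lifting) cubic_apply_swap12 cubic_apply_swap23 expand sum.cong)
    have 2: "cubic_apply T (d b) \<beta> \<gamma> = (\<Sum>c\<in>E. covector_apply \<beta> c * cubic_apply T (d b) (d c) \<gamma>)"
      for b
      using expand[of \<beta> "d b" \<gamma>] by (simp add: cubic_apply_swap12[of T _ "d b"])
    show ?thesis
      by (simp add: expand[of \<alpha>] 2 3 sum_distrib_left mult.assoc)
  qed
  have perm: "cubic_apply T \<alpha> \<gamma> \<beta> = cubic_apply T \<alpha> \<beta> \<gamma>"
    "cubic_apply T \<beta> \<alpha> \<gamma> = cubic_apply T \<alpha> \<beta> \<gamma>"
    "cubic_apply T \<gamma> \<alpha> \<beta> = cubic_apply T \<alpha> \<beta> \<gamma>"
    "cubic_apply T \<beta> \<gamma> \<alpha> = cubic_apply T \<alpha> \<beta> \<gamma>"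
    "cubic_apply T \<gamma> \<beta> \<alpha> = cubic_apply T \<alpha> \<beta> \<gamma>" for \<alpha> \<beta> \<gamma>
    by (metis cubic_apply_swap12 cubic_apply_swap23)+
  have "T = (\<Sum>b\<in>E. \<Sum>c\<in>E. \<Sum>e\<in>E. ?t b c e *\<^sub>R sym_prod b c e)" (is "_ = ?R")
  proof -
    have "cubic_apply T \<alpha> \<beta> \<gamma> = cubic_apply ?R \<alpha> \<beta> \<gamma>" for \<alpha> \<beta> \<gamma>
    proof -
      let ?P = "\<lambda>\<alpha> \<beta> \<gamma>. \<Sum>b\<in>E. \<Sum>c\<in>E. \<Sum>e\<in>E.
        covector_apply \<alpha> b * covector_apply \<beta> c * covector_apply \<gamma> e * ?t b c e"
      \<comment> \<open>Each \<open>sym_prod\<close> averages over the six permutations of the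
        arguments, so \<open>?R\<close> is the average of six permuted copies of the expansion
        \<open>full\<close>; all six equal \<open>T\<close> by symmetry.\<close>
      have "cubic_apply ?R \<alpha> \<beta> \<gamma>
          = (?P \<alpha> \<beta> \<gamma> + ?P \<alpha> \<gamma> \<beta> + ?P \<beta> \<alpha> \<gamma> + ?P \<gamma> \<alpha> \<beta> + ?P \<beta> \<gamma> \<alpha> + ?P \<gamma> \<beta> \<alpha>) / 6"
        unfolding cubic_apply_sum scaleR_cubic_form.rep_eq cubic_apply_sym_prod Let_def
          sum.distrib[symmetric] sum_divide_distrib
        by (intro sum.cong refl) (simp add: algebra_simps)
      also have "\<dots> = cubic_apply T \<alpha> \<beta> \<gamma>"
        unfolding full[symmetric]
        by (simp add: perm[where \<alpha> = \<alpha> and \<beta> = \<beta> and \<gamma> = \<gamma>])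
      finally show ?thesis by simp
    qed
    then show ?thesis
      by (intro cubic_apply_inject[THEN iffD1] ext)
  qed
  moreover have "?R \<in> sym_cube_of U"
    using E(1) by (intro subspace_sum subspace_scale subspace_sym_cube_of sym_prod_in_sym_cube_of) auto
  ultimately show ?thesis by simp
qed

section \<open>Linear algebra of a symplectic form\<close>

locale symplectic_space =
  fixes \<omega> :: "'a::real_vector \<Rightarrow> 'a \<Rightarrow> real"
  assumes fin_dim: "finite_dimensional TYPE('a)" and symp: "symplectic_form \<omega>"
begin

lemma bil: "bilinear \<omega>" and self [simp]: "\<omega> x x = 0" and nondeg: "(\<And>y. \<omega> x y = 0) \<Longrightarrow> x = 0"
  using symp by (auto simp: symplectic_form_def)

lemmas form_simps =
  bilinear_ladd[OF bil] bilinear_radd[OF bil] bilinear_lmul[OF bil] bilinear_rmul[OF bil]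
  bilinear_lzero[OF bil] bilinear_rzero[OF bil] bilinear_lsub[OF bil] bilinear_rsub[OF bil]

lemma linear_left: "linear (\<lambda>x. \<omega> x y)" and linear_right: "linear (\<omega> x)"
  using bil by (auto simp: bilinear_def eta_contract_eq)

lemma skew: "\<omega> x y = - \<omega> y x"
  using self[of "x + y"] by (simp add: form_simps del: self) (simp add: self)

lemma sum_left: "\<omega> (\<Sum>i\<in>I. f i) y = (\<Sum>i\<in>I. \<omega> (f i) y)"
  by (rule linear_sum[OF linear_left])

lemma sum_right: "\<omega> y (\<Sum>i\<in>I. f i) = (\<Sum>i\<in>I. \<omega> y (f i))"
  by (rule linear_sum[OF linear_right])

lemma lagrangian_subspace: "lagrangian \<omega> U \<Longrightarrow> subspace U"
  and lagrangian_isotropic: "\<lbrakk>lagrangian \<omega> U; u \<in> U; v \<in> U\<rbrakk> \<Longrightarrow> \<omega> u v = 0"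
  and lagrangian_maximal: "\<lbrakk>lagrangian \<omega> U; \<And>u. u \<in> U \<Longrightarrow> \<omega> u v = 0\<rbrakk> \<Longrightarrow> v \<in> U"
  unfolding lagrangian_def by blast+

text \<open>The map \<open>\<phi>\<close> records the values of \<open>\<omega>\<close> against
  \<open>v\<close> on a basis as the coordinates of a vector, so it is an endomorphism of the space
  itself. Nondegeneracy makes it injective, hence surjective, and a preimage of the vector with
  coordinates \<open>f b\<close> represents \<open>f\<close>.\<close>

lemma riesz:
  assumes f: "linear f"
  obtains v where "\<And>x. f x = \<omega> x v"
proof -
  obtain B :: "'a set" where B: "finite B" "independent B" "span B = UNIV"
    using finite_dimensional_basis[OF fin_dim independent_empty] by metis
  define \<phi> where "\<phi> v = (\<Sum>b\<in>B. \<omega> b v *\<^sub>R b)" for v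
  have lin: "linear \<phi>"
    by (simp add: linear_iff \<phi>_def form_simps scaleR_add_left sum.distrib scaleR_sum_right)
  have coeff: "p b = q b"
    if "(\<Sum>b\<in>B. p b *\<^sub>R b) = (\<Sum>b\<in>B. q b *\<^sub>R b)" "b \<in> B" for p q :: "'a \<Rightarrow> real" and b
  proof -
    have "(\<Sum>b\<in>B. (p b - q b) *\<^sub>R b) = 0"
      using that(1) by (simp add: scaleR_diff_left sum_subtractf)
    then show ?thesis
      using independentD[OF B(2,1) order_refl] that(2) by fastforce
  qed
  have "inj \<phi>"
  proof (subst linear_injective_0[OF lin], intro allI impI)
    fix v assume "\<phi> v = 0"
    then have "\<omega> b v = 0" if "b \<in> B" for b
      using coeff[of "\<lambda>b. \<omega> b v" "\<lambda>_. 0" b] that by (simp add: \<phi>_def)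
    then have "\<omega> x v = 0" for x
      using linear_eq_on[OF linear_left linear_zero, of x B v] B(3) by simp
    then show "v = 0" using nondeg[of v] skew by (metis neg_equal_0_iff_equal)
  qed
  then have "surj \<phi>"
    by (rule finite_dimensional_inj_imp_surj[OF fin_dim lin])
  then obtain v where v: "\<phi> v = (\<Sum>b\<in>B. f b *\<^sub>R b)" by (metis surjD)
  have "f b = \<omega> b v" if "b \<in> B" for b
    using coeff[of "\<lambda>b. \<omega> b v" f b] v that by (simp add: \<phi>_def)
  then have "f x = \<omega> x v" for x
    using linear_eq_on[OF f linear_left, of x B v] B(3) by simp
  then show ?thesis by (rule that)
qed

text \<open>Preserving a nondegenerate form forces a trivial kernel, and in finite dimension
  injectivity gives bijectivity.\<close>

lemma preserving_in_Sp_group: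
  assumes lin: "linear g" and pres: "\<And>x y. \<omega> (g x) (g y) = \<omega> x y"
  shows "g \<in> Sp_group \<omega>"
proof -
  have inj: "inj g"
  proof (subst linear_injective_0[OF lin], intro allI impI)
    fix v assume "g v = 0"
    then show "v = 0" using nondeg[of v] pres[of v] by (simp add: form_simps)
  qed
  moreover have "surj g"
    by (rule finite_dimensional_inj_imp_surj[OF fin_dim lin inj])
  ultimately show ?thesis
    using lin pres by (simp add: Sp_group_def bij_def)
qed

lemma Sp_group_inv:
  assumes "g \<in> Sp_group \<omega>"
  shows "inv g \<in> Sp_group \<omega>"
proof -
  have g: "linear g" "bij g" "\<And>x y. \<omega> (g x) (g y) = \<omega> x y"
    using assms by (auto simp: Sp_group_def)
  have gi: "g (inv g x) = x" for x using g(2) by (simp add: bij_is_surj surj_f_inv_f)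
  have "linear (inv g)"
    unfolding linear_iff
    by (intro conjI allI inv_f_eq[OF bij_is_inj[OF g(2)]])
      (simp_all add: gi linear_add[OF g(1)] linear_cmul[OF g(1)])
  moreover have "\<omega> (inv g x) (inv g y) = \<omega> x y" for x y
    using g(3)[of "inv g x" "inv g y"] by (simp add: gi)
  ultimately show ?thesis by (rule preserving_in_Sp_group)
qed

section \<open>Lagrangian subspaces: existence, adapted bases, transitivity of the symplectic
  group\<close>

text \<open>Zorn's lemma is applied to isotropic sets rather than subspaces. Any \<open>v\<close>
  orthogonal to a maximal \<open>M\<close> can be adjoined because \<open>\<omega>\<close> is
  alternating, so \<open>M\<close> is its own orthogonal, and an orthogonal is always a
  subspace.\<close>

lemma isotropic_extends_to_lagrangian:
  assumes W: "\<And>x y. x \<in> W \<Longrightarrow> y \<in> W \<Longrightarrow> \<omega> x y = 0"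
  obtains U where "lagrangian \<omega> U" "W \<subseteq> U"
proof -
  define A where "A = {M. W \<subseteq> M \<and> (\<forall>x\<in>M. \<forall>y\<in>M. \<omega> x y = 0)}"
  have "\<exists>M\<in>A. \<forall>X\<in>A. M \<subseteq> X \<longrightarrow> X = M"
  proof (rule subset_Zorn_nonempty)
    show "A \<noteq> {}" using W by (auto simp: A_def)
  next
    fix C assume C: "C \<noteq> {}" "subset.chain A C"
    have "\<omega> x y = 0" if "x \<in> X" "X \<in> C" "y \<in> Y" "Y \<in> C" for x y X Y
    proof -
      have "X \<subseteq> Y \<or> Y \<subseteq> X" "X \<in> A" "Y \<in> A"
        using C that by (auto simp: subset_chain_def)
      then show ?thesis using that by (auto simp: A_def)
    qed
    then show "\<Union>C \<in> A"
      using C unfolding A_def subset_chain_def by blast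
  qed
  then obtain M where M: "M \<in> A" "\<And>X. X \<in> A \<Longrightarrow> M \<subseteq> X \<Longrightarrow> X = M" by blast
  have eq: "M = {v. \<forall>u\<in>M. \<omega> u v = 0}"
  proof
    show "M \<subseteq> {v. \<forall>u\<in>M. \<omega> u v = 0}" using M(1) by (auto simp: A_def)
  next
    show "{v. \<forall>u\<in>M. \<omega> u v = 0} \<subseteq> M"
    proof
      fix v assume v: "v \<in> {v. \<forall>u\<in>M. \<omega> u v = 0}"
      then have "\<omega> v u = 0" if "u \<in> M" for u using that skew[of v u] by simp
      with v have "insert v M \<in> A" using M(1) by (auto simp: A_def)
      then show "v \<in> M" using M(2) by blast
    qed
  qed
  have "subspace {v. \<forall>u\<in>M. \<omega> u v = 0}"
    by (simp add: subspace_def form_simps)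
  then have "lagrangian \<omega> M" using eq by (simp add: lagrangian_def)
  moreover have "W \<subseteq> M" using M(1) by (simp add: A_def)
  ultimately show ?thesis by (rule that)
qed

text \<open>Coordinates in which \<open>\<omega>\<close> is standard: \<open>E\<close> is a basis of
  \<open>U\<close>, and \<open>f\<close> supplies dual vectors spanning an isotropic complement.
  Symplectic maps can then be defined coordinatewise.\<close>

lemma lagrangian_symplectic_basis:
  assumes U: "lagrangian \<omega> U"
  obtains E f where "finite E" "E \<subseteq> U" "U \<subseteq> span E"
    "\<And>b c. b \<in> E \<Longrightarrow> c \<in> E \<Longrightarrow> \<omega> b (f c) = (if b = c then 1 else 0)"
    "\<And>b c. b \<in> E \<Longrightarrow> c \<in> E \<Longrightarrow> \<omega> (f b) (f c) = 0"
    "\<And>v. v = (\<Sum>b\<in>E. \<omega> v (f b) *\<^sub>R b + \<omega> b v *\<^sub>R f b)"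
proof -
  obtain E where E: "E \<subseteq> U" "independent E" "U \<subseteq> span E"
    using maximal_independent_subset[of U] by metis
  obtain B where B: "E \<subseteq> B" "finite B" "independent B" "span B = UNIV"
    using finite_dimensional_basis[OF fin_dim E(2)] .
  have finE: "finite E" using B finite_subset by blast
  have iso: "\<omega> b c = 0" if "b \<in> E" "c \<in> E" for b c
    using lagrangian_isotropic[OF U] that E(1) by blast
  \<comment> \<open>Vectors dual to \<open>E\<close>, found by representing the coordinate
    functionals of \<open>B\<close> through \<open>\<omega>\<close>; they need not yet be orthogonal
    to each other.\<close>
  have "\<exists>v. \<forall>x. representation B x c = \<omega> x v" for c
  proof -
    have "linear (\<lambda>x. representation B x c)"
      using B by (simp add: linear_iff representation_add representation_scale)
    then show ?thesis using riesz by metis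
  qed
  then obtain f0 where f0: "\<And>c x. representation B x c = \<omega> x (f0 c)" by metis
  have dual0: "\<omega> b (f0 c) = (if b = c then 1 else 0)" if "b \<in> E" for b c
    using f0[of b c] representation_basis[OF B(3), of b] that B(1) by auto
  \<comment> \<open>The correction term makes the span of the dual vectors isotropic.\<close>
  define f where "f c = f0 c - (1/2) *\<^sub>R (\<Sum>k\<in>E. \<omega> (f0 c) (f0 k) *\<^sub>R k)" for c
  have dual: "\<omega> b (f c) = (if b = c then 1 else 0)" if "b \<in> E" "c \<in> E" for b c
    using that iso by (simp add: f_def form_simps sum_right dual0)
  have corr: "\<omega> (f0 b) (\<Sum>k\<in>E. p k *\<^sub>R k) = - p b" if "b \<in> E" for b p
  proof -
    have "\<omega> (f0 b) (\<Sum>k\<in>E. p k *\<^sub>R k) = (\<Sum>k\<in>E. - (if k = b then p k else 0))"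
      unfolding sum_right by (rule sum.cong) (auto simp: form_simps skew[of "f0 b"] dual0)
    then show ?thesis using that finE by (simp add: sum_negf)
  qed
  \<comment> \<open>Each of the two corrections contributes minus one half of
    \<open>\<omega> (f0 b) (f0 c)\<close>, and the product of the corrections vanishes since
    \<open>E\<close> is isotropic.\<close>
  have dual_iso: "\<omega> (f b) (f c) = 0" if "b \<in> E" "c \<in> E" for b c
  proof -
    have "\<omega> (\<Sum>k\<in>E. p k *\<^sub>R k) (\<Sum>k\<in>E. q k *\<^sub>R k) = 0" for p q
      using iso by (simp add: sum_left sum_right form_simps)
    then show ?thesis
      using corr[OF that(1), of "\<lambda>k. \<omega> (f0 c) (f0 k)"] corr[OF that(2), of "\<lambda>k. \<omega> (f0 b) (f0 k)"]
        skew[of "\<Sum>k\<in>E. \<omega> (f0 b) (f0 k) *\<^sub>R k" "f0 c"] skew[of "f0 b" "f0 c"]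
      by (simp add: f_def form_simps)
  qed
  have expand: "v = (\<Sum>b\<in>E. \<omega> v (f b) *\<^sub>R b + \<omega> b v *\<^sub>R f b)" for v
  proof -
    \<comment> \<open>The remainder \<open>r\<close> is orthogonal to \<open>E\<close>, hence lies
      in \<open>U\<close> by maximality and is a combination of \<open>E\<close>; pairing with the
      \<open>f c\<close> then kills its coefficients.\<close>
    define r where "r = v - (\<Sum>b\<in>E. \<omega> v (f b) *\<^sub>R b + \<omega> b v *\<^sub>R f b)"
    have rE: "\<omega> c r = 0" if "c \<in> E" for c
    proof -
      have "\<omega> c (\<Sum>b\<in>E. \<omega> v (f b) *\<^sub>R b + \<omega> b v *\<^sub>R f b) = (\<Sum>b\<in>E. if b = c then \<omega> b v else 0)"
        unfolding sum_right by (rule sum.cong) (use that in \<open>auto simp: form_simps dual iso\<close>)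
      then show ?thesis using that finE by (simp add: r_def form_simps)
    qed
    have rf: "\<omega> r (f c) = 0" if "c \<in> E" for c
    proof -
      have "\<omega> (\<Sum>b\<in>E. \<omega> v (f b) *\<^sub>R b + \<omega> b v *\<^sub>R f b) (f c)
          = (\<Sum>b\<in>E. if b = c then \<omega> v (f b) else 0)"
        unfolding sum_left by (rule sum.cong) (use that in \<open>auto simp: form_simps dual dual_iso\<close>)
      then show ?thesis using that finE by (simp add: r_def form_simps)
    qed
    have "\<omega> u r = 0" if "u \<in> U" for u
      using linear_eq_on[OF linear_left linear_zero, of u E r] rE E(3) that by auto
    then have "r \<in> U" by (rule lagrangian_maximal[OF U])
    then have "r \<in> span E" using E(3) by blast
    then obtain p where p: "r = (\<Sum>b\<in>E. p b *\<^sub>R b)"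
      using span_finite[OF finE] by auto
    have "p c = 0" if "c \<in> E" for c
    proof -
      have "\<omega> r (f c) = (\<Sum>b\<in>E. if b = c then p b else 0)"
        unfolding p sum_left by (rule sum.cong) (use that in \<open>auto simp: form_simps dual\<close>)
      then show ?thesis using rf[OF that] that finE by simp
    qed
    then have "r = 0" by (simp add: p)
    then show ?thesis by (simp add: r_def)
  qed
  show ?thesis
    by (rule that[OF finE E(1,3) dual dual_iso expand])
qed

text \<open>Both halves of the basis are families over one index set, so that the formula also
  applies to the images \<open>h b\<close> and \<open>f' (h b)\<close>, indexed by
  \<open>E\<close>.\<close>

lemma form_in_symplectic_basis:
  assumes fin: "finite I"
    and ee: "\<And>i j. i \<in> I \<Longrightarrow> j \<in> I \<Longrightarrow> \<omega> (e i) (e j) = 0"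
    and ff: "\<And>i j. i \<in> I \<Longrightarrow> j \<in> I \<Longrightarrow> \<omega> (f i) (f j) = 0"
    and ef: "\<And>i j. i \<in> I \<Longrightarrow> j \<in> I \<Longrightarrow> \<omega> (e i) (f j) = (if i = j then 1 else 0)"
  shows "\<omega> (\<Sum>i\<in>I. a i *\<^sub>R e i + p i *\<^sub>R f i) (\<Sum>i\<in>I. b i *\<^sub>R e i + q i *\<^sub>R f i)
    = (\<Sum>i\<in>I. a i * q i - p i * b i)"
proof -
  have fe: "\<omega> (f i) (e j) = (if i = j then -1 else 0)" if "i \<in> I" "j \<in> I" for i j
    using that by (subst skew) (simp add: ef)
  have "\<omega> (a i *\<^sub>R e i + p i *\<^sub>R f i) (\<Sum>i\<in>I. b i *\<^sub>R e i + q i *\<^sub>R f i) = a i * q i - p i * b i"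
    if "i \<in> I" for i
  proof -
    have "\<omega> (a i *\<^sub>R e i + p i *\<^sub>R f i) (\<Sum>i\<in>I. b i *\<^sub>R e i + q i *\<^sub>R f i)
      = (\<Sum>j\<in>I. if i = j then a j * q j - p j * b j else 0)"
      unfolding sum_right
      by (rule sum.cong) (use that in \<open>auto simp: form_simps ee ff ef fe algebra_simps\<close>)
    then show ?thesis using fin that by simp
  qed
  then show ?thesis unfolding sum_left by (rule sum.cong[OF refl])
qed

text \<open>An injection between bases gives a symplectic map of one Lagrangian subspace into the
  other, which is onto since a Lagrangian subspace is maximal isotropic; so the dimensions need not
  be computed.\<close>
lemma Sp_transitive_on_lagrangians:
  assumes U: "lagrangian \<omega> U" and U': "lagrangian \<omega> U'"
  obtains g where "g \<in> Sp_group \<omega>" "g ` U \<subseteq> U'"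
proof -
  \<comment> \<open>Stated for arbitrary subspaces and bases, so that it can be used in either
    direction, according to which basis is larger.\<close>
  have *: "\<exists>g\<in>Sp_group \<omega>. g ` U = U'"
    if U: "lagrangian \<omega> U" and U': "lagrangian \<omega> U'"
      and E: "finite E" "E \<subseteq> U" "U \<subseteq> span E"
        "\<And>b c. b \<in> E \<Longrightarrow> c \<in> E \<Longrightarrow> \<omega> b (f c) = (if b = c then 1 else 0)"
        "\<And>b c. b \<in> E \<Longrightarrow> c \<in> E \<Longrightarrow> \<omega> (f b) (f c) = 0"
        "\<And>v. v = (\<Sum>b\<in>E. \<omega> v (f b) *\<^sub>R b + \<omega> b v *\<^sub>R f b)"
      and E': "finite E'" "E' \<subseteq> U'"
        "\<And>b c. b \<in> E' \<Longrightarrow> c \<in> E' \<Longrightarrow> \<omega> b (f' c) = (if b = c then 1 else 0)"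
        "\<And>b c. b \<in> E' \<Longrightarrow> c \<in> E' \<Longrightarrow> \<omega> (f' b) (f' c) = 0"
      and card: "card E \<le> card E'" for U U' E E' f f'
  proof -
    obtain h where h: "h ` E \<subseteq> E'" "inj_on h E"
      using card_le_inj[OF E(1) E'(1) card] by blast
    have hE: "h b \<in> E'" if "b \<in> E" for b using h that by blast
    \<comment> \<open>The linear map sending \<open>b\<close> to \<open>h b\<close> and
      \<open>f b\<close> to \<open>f' (h b)\<close>.\<close>
    define g where "g v = (\<Sum>b\<in>E. \<omega> v (f b) *\<^sub>R h b + \<omega> b v *\<^sub>R f' (h b))" for v
    have lin: "linear g"
      by (simp add: linear_iff g_def form_simps scaleR_add_left sum.distrib scaleR_sum_right
          scaleR_add_right)
    have "\<omega> (g x) (g y) = \<omega> x y" for x y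
    proof -
      have iso: "\<omega> b c = 0" if "b \<in> E" "c \<in> E" for b c
        using lagrangian_isotropic[OF U] that E(2) by blast
      have iso': "\<omega> (h b) (h c) = 0" if "b \<in> E" "c \<in> E" for b c
        using lagrangian_isotropic[OF U'] that hE E'(2) by blast
      have "\<omega> x y = (\<Sum>b\<in>E. \<omega> x (f b) * \<omega> b y - \<omega> b x * \<omega> y (f b))"
        by (subst (1) E(6)[of x], subst (1) E(6)[of y],
            rule form_in_symplectic_basis[OF E(1) iso E(5,4)])
      also have "\<dots> = \<omega> (g x) (g y)"
        unfolding g_def
        by (rule form_in_symplectic_basis[OF E(1) iso', symmetric])
          (use h(2) hE in \<open>auto simp: E'(3,4) inj_on_eq_iff\<close>)
      finally show ?thesis by simp
    qed
    then have g: "g \<in> Sp_group \<omega>" by (rule preserving_in_Sp_group[OF lin])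
    have gU: "g u \<in> U'" if "u \<in> U" for u
    proof -
      have "g u = (\<Sum>b\<in>E. \<omega> u (f b) *\<^sub>R h b)"
        unfolding g_def
        by (rule sum.cong) (use lagrangian_isotropic[OF U _ that] E(2) in auto)
      then show ?thesis
        using hE E'(2) lagrangian_subspace[OF U'] by (auto intro!: subspace_sum subspace_scale)
    qed
    have "U' \<subseteq> g ` U"
    proof
      fix u' assume u': "u' \<in> U'"
      have "surj g" using g by (simp add: Sp_group_def bij_is_surj)
      then obtain x where x: "u' = g x" by (rule surjE)
      \<comment> \<open>Since \<open>g\<close> preserves \<open>\<omega>\<close> and both
        \<open>g u\<close> and \<open>g x\<close> lie in the isotropic \<open>U'\<close>, the
        preimage \<open>x\<close> is orthogonal to \<open>U\<close>.\<close>
      have "\<omega> u x = 0" if "u \<in> U" for u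
        using g lagrangian_isotropic[OF U' gU[OF that] u'] x by (simp add: Sp_group_def)
      then show "u' \<in> g ` U" using lagrangian_maximal[OF U] x by blast
    qed
    with gU g show ?thesis by blast
  qed
  obtain E f where E: "finite E" "E \<subseteq> U" "U \<subseteq> span E"
    "\<And>b c. b \<in> E \<Longrightarrow> c \<in> E \<Longrightarrow> \<omega> b (f c) = (if b = c then 1 else 0)"
    "\<And>b c. b \<in> E \<Longrightarrow> c \<in> E \<Longrightarrow> \<omega> (f b) (f c) = 0"
    "\<And>v. v = (\<Sum>b\<in>E. \<omega> v (f b) *\<^sub>R b + \<omega> b v *\<^sub>R f b)"
    using lagrangian_symplectic_basis[OF U] by blast
  obtain E' f' where E': "finite E'" "E' \<subseteq> U'" "U' \<subseteq> span E'"
    "\<And>b c. b \<in> E' \<Longrightarrow> c \<in> E' \<Longrightarrow> \<omega> b (f' c) = (if b = c then 1 else 0)"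
    "\<And>b c. b \<in> E' \<Longrightarrow> c \<in> E' \<Longrightarrow> \<omega> (f' b) (f' c) = 0"
    "\<And>v. v = (\<Sum>b\<in>E'. \<omega> v (f' b) *\<^sub>R b + \<omega> b v *\<^sub>R f' b)"
    using lagrangian_symplectic_basis[OF U'] by blast
  show ?thesis
  proof (cases "card E \<le> card E'")
    case True
    then show ?thesis using *[OF U U' E E'(1,2,4,5)] that by blast
  next
    case False
    \<comment> \<open>The map is built from \<open>U'\<close> to \<open>U\<close> and then inverted,
      which relies on the image being all of \<open>U\<close>.\<close>
    then obtain g where g: "g \<in> Sp_group \<omega>" "g ` U' = U"
      using *[OF U' U E' E(1,2,4,5)] by auto
    then have "inv g ` U = U'"
      by (auto simp: Sp_group_def bij_def image_inv_f_f)
    then show ?thesis using that Sp_group_inv[OF g(1)] by blast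
  qed
qed

section \<open>Comparison of \<open>C_sp\<close> with the cubes of Lagrangian subspaces\<close>

lemma cubic_apply_flat:
  "cubic_apply (sym_cube_flat \<omega> T) X Y Z
    = cubic_apply T (Covector (\<lambda>v. \<omega> v X)) (Covector (\<lambda>v. \<omega> v Y)) (Covector (\<lambda>v. \<omega> v Z))"
  and linear_sym_cube_flat: "linear (sym_cube_flat \<omega>)"
proof -
  have *: "linear (\<lambda>X. Covector (\<lambda>v. \<omega> v X))"
    unfolding linear_iff covector_apply_inject[symmetric] plus_covector.rep_eq
      scaleR_covector.rep_eq covector_apply_Covector[OF linear_left]
    by (simp add: form_simps)
  show "cubic_apply (sym_cube_flat \<omega> T) X Y Z
    = cubic_apply T (Covector (\<lambda>v. \<omega> v X)) (Covector (\<lambda>v. \<omega> v Y)) (Covector (\<lambda>v. \<omega> v Z))"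
    unfolding sym_cube_flat_def by (rule cubic_apply_pullback[OF *])
  show "linear (sym_cube_flat \<omega>)"
    using linear_cubic_pullback[OF *] unfolding sym_cube_flat_def[abs_def] .
qed

lemma commuting_prolongation_isotropic:
  assumes S: "S \<in> commuting_prolongation (sp_algebra \<omega>)"
  shows "\<omega> (S X Z) (S Y W) = 0"
proof -
  have sym: "S X Y = S Y X" and sp: "\<omega> (S X Y) Z = - \<omega> Y (S X Z)"
    and comm: "S X (S Y Z) = S Y (S X Z)" for X Y Z
    using S by (auto simp: commuting_prolongation_def first_prolongation_def sp_algebra_def
        eq_neg_iff_add_eq_0)
  define G where "G X Z Y W = \<omega> (S X Z) (S Y W)" for X Z Y W
  \<comment> \<open>Moving one operator across \<open>\<omega>\<close>, the two sides are minus the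
    pairings of \<open>S Y (S X Z)\<close> and of \<open>S X (S Y Z)\<close> with \<open>W\<close>,
    which agree by commutativity.\<close>
  have "G X Z Y W = G Y Z X W" for X Z Y W
    using sp[of Y "S X Z" W] sp[of X "S Y Z" W] comm[of X Y Z] by (simp add: G_def)
  moreover have "G X Z Y W = G Z X Y W" "G X Z Y W = G X Z W Y" "G X Z Y W = - G Y W X Z"
    for X Z Y W
    unfolding G_def by (simp_all only: sym[of X Z] sym[of Y W], rule skew)
  ultimately have "G X Z Y W = - G X Z Y W" by metis
  then show ?thesis by (simp add: G_def)
qed

lemma C_sp_in_lagrangian_cube:
  assumes T: "T \<in> C_sp \<omega>"
  obtains U where "lagrangian \<omega> U" "T \<in> sym_cube_of U"
proof -
  obtain S where S: "S \<in> commuting_prolongation (sp_algebra \<omega>)"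
    and TS: "sym_cube_flat \<omega> T = prolongation_form \<omega> S"
    using T by (auto simp: C_sp_def)
  obtain U where U: "lagrangian \<omega> U" "{S X Y | X Y. True} \<subseteq> U"
    by (rule isotropic_extends_to_lagrangian[of "{S X Y | X Y. True}"])
      (auto simp: commuting_prolongation_isotropic[OF S])
  have SU: "S X Y \<in> U" for X Y using U(2) by blast
  have "S \<in> first_prolongation (sp_algebra \<omega>)"
    using S by (simp add: commuting_prolongation_def)
  note form = cubic_apply_prolongation_form[OF symp this]
  have "T \<in> sym_cube_of U"
  proof (rule sym_cube_of_annihilator[OF fin_dim lagrangian_subspace[OF U(1)]])
    fix \<alpha> \<beta> \<gamma> :: "'a covector"
    assume \<alpha>: "\<And>u. u \<in> U \<Longrightarrow> covector_apply \<alpha> u = 0"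
    \<comment> \<open>Covectors become vectors through \<open>\<omega>\<close>; annihilating
      \<open>U\<close> then means lying in the orthogonal of \<open>U\<close>, which is
      \<open>U\<close>.\<close>
    have ex: "\<exists>X. \<delta> = Covector (\<lambda>v. \<omega> v X)" for \<delta> :: "'a covector"
    proof -
      obtain X where "\<And>x. covector_apply \<delta> x = \<omega> x X"
        using riesz[OF linear_covector_apply] by blast
      then have "covector_apply \<delta> = (\<lambda>v. \<omega> v X)" by blast
      then show ?thesis by (metis covector_apply_inverse)
    qed
    obtain X Y Z where XYZ: "\<alpha> = Covector (\<lambda>v. \<omega> v X)" "\<beta> = Covector (\<lambda>v. \<omega> v Y)"
      "\<gamma> = Covector (\<lambda>v. \<omega> v Z)"
      using ex by metis
    have "X \<in> U"
      using \<alpha> by (intro lagrangian_maximal[OF U(1)])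
        (simp add: XYZ covector_apply_Covector linear_left)
    \<comment> \<open>By symmetry of the cubic form the argument \<open>X\<close> may be moved to
      the last slot, where it is paired with an element of the image of \<open>S\<close>.\<close>
    then have "\<omega> (S Y Z) X = 0" by (rule lagrangian_isotropic[OF U(1) SU])
    then show "cubic_apply T \<alpha> \<beta> \<gamma> = 0"
      unfolding XYZ cubic_apply_flat[symmetric] TS
      by (metis form cubic_apply_swap12 cubic_apply_swap23)
  qed
  with U(1) show ?thesis by (rule that)
qed

lemma lagrangian_cube_subset_C_sp:
  assumes U: "lagrangian \<omega> U"
  shows "sym_cube_of U \<subseteq> C_sp \<omega>"
proof
  fix T assume T: "T \<in> sym_cube_of U"
  note sub = lagrangian_subspace[OF U] and iso = lagrangian_isotropic[OF U]
  \<comment> \<open>Commutativity is quadratic in \<open>S\<close>. It is replaced by linear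
    conditions that imply it: \<open>S Y Z\<close> lies in \<open>U\<close> and \<open>S X\<close>
    kills \<open>U\<close>, so both products vanish. Hence it suffices to treat the spanning
    products \<open>sym_prod u v w\<close>.\<close>
  define good where "good S \<longleftrightarrow> S \<in> first_prolongation (sp_algebra \<omega>) \<and>
    (\<forall>X Y. S X Y \<in> U) \<and> (\<forall>X. \<forall>u\<in>U. S X u = 0) \<and> (\<forall>X. endo_trace (S X) = 0)" for S
  define D where "D = {T. \<exists>S. good S \<and> (\<forall>X Y Z. cubic_apply (sym_cube_flat \<omega> T) X Y Z = \<omega> (S X Y) Z)}"
  have tr: "endo_trace (\<lambda>x. \<omega> u x *\<^sub>R w) = \<omega> u w" for u w
    by (rule endo_trace_rank_one[OF fin_dim linear_right])
  have fp: "S \<in> first_prolongation (sp_algebra \<omega>) \<longleftrightarrow>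
      bilinear S \<and> (\<forall>X Y Z. \<omega> (S X Y) Z + \<omega> Y (S X Z) = 0) \<and> (\<forall>X Y. S X Y = S Y X)" for S
    unfolding first_prolongation_def sp_algebra_def bilinear_def mem_Collect_eq by blast
  have "sym_cube_of U \<subseteq> D"
    unfolding sym_cube_of_def
  proof (rule span_minimal)
    show "subspace D"
      unfolding subspace_def
    proof (intro conjI ballI allI)
      have "good (\<lambda>_ _. 0)"
        using endo_trace_scaleR[of 0 "\<lambda>_. 0"] subspace_0[OF sub]
        by (simp add: good_def fp form_simps bilinear_def linear_zero)
      then show "0 \<in> D"
        unfolding D_def
        by (intro CollectI exI[of _ "\<lambda>_ _. 0"])
          (simp add: linear_0[OF linear_sym_cube_flat] zero_cubic_form.rep_eq form_simps)
    next
      fix T T' assume "T \<in> D" "T' \<in> D"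
      then obtain S S' where S: "good S" "\<And>X Y Z. cubic_apply (sym_cube_flat \<omega> T) X Y Z = \<omega> (S X Y) Z"
        "good S'" "\<And>X Y Z. cubic_apply (sym_cube_flat \<omega> T') X Y Z = \<omega> (S' X Y) Z"
        by (auto simp: D_def)
      have "good (\<lambda>X Y. S X Y + S' X Y)"
        using S(1,3) endo_trace_add[of "S _" "S' _"] subspace_add[OF sub]
        unfolding good_def fp form_simps bilinear_def linear_iff
        by (simp add: algebra_simps)
      then show "T + T' \<in> D"
        unfolding D_def
        by (intro CollectI exI[of _ "\<lambda>X Y. S X Y + S' X Y"])
          (simp add: linear_add[OF linear_sym_cube_flat] plus_cubic_form.rep_eq form_simps S)
    next
      fix c T assume "T \<in> D"
      then obtain S where S: "good S" "\<And>X Y Z. cubic_apply (sym_cube_flat \<omega> T) X Y Z = \<omega> (S X Y) Z"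
        by (auto simp: D_def)
      have "good (\<lambda>X Y. c *\<^sub>R S X Y)"
        using S(1) endo_trace_scaleR[of c "S _"] subspace_scale[OF sub]
        unfolding good_def fp form_simps bilinear_def linear_iff
        by (simp add: algebra_simps flip: distrib_left)
      then show "c *\<^sub>R T \<in> D"
        unfolding D_def
        by (intro CollectI exI[of _ "\<lambda>X Y. c *\<^sub>R S X Y"])
          (simp add: linear_cmul[OF linear_sym_cube_flat] scaleR_cubic_form.rep_eq form_simps S)
    qed
  next
    show "{sym_prod u v w | u v w. u \<in> U \<and> v \<in> U \<and> w \<in> U} \<subseteq> D"
    proof clarify
      fix u v w assume uvw: "u \<in> U" "v \<in> U" "w \<in> U"
      \<comment> \<open>Read off from \<open>sym_cube_flat_prod\<close> by removing the pairing with
        \<open>Z\<close>. The terms are grouped by their factor in \<open>Y\<close>, so that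
        \<open>S X\<close> is a sum of three rank-one maps to which \<open>tr\<close> applies; each
        trace is a pairing of elements of \<open>U\<close>.\<close>
      define S where "S X Y = \<omega> u Y *\<^sub>R (1/6) *\<^sub>R (\<omega> w X *\<^sub>R v + \<omega> v X *\<^sub>R w)
        + (\<omega> v Y *\<^sub>R (1/6) *\<^sub>R (\<omega> w X *\<^sub>R u + \<omega> u X *\<^sub>R w)
        + \<omega> w Y *\<^sub>R (1/6) *\<^sub>R (\<omega> v X *\<^sub>R u + \<omega> u X *\<^sub>R v))" for X Y
      have "endo_trace (S X) = 0" for X
        unfolding S_def[abs_def] endo_trace_add tr using uvw by (simp add: form_simps iso)
      moreover have "bilinear S"
        by (simp add: bilinear_def linear_iff S_def form_simps algebra_simps add_divide_distrib)
      moreover have "\<omega> (S X Y) Z + \<omega> Y (S X Z) = 0" for X Y Z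
        by (simp add: S_def form_simps skew[of Y u] skew[of Y v] skew[of Y w] algebra_simps)
      moreover have "S X Y = S Y X" for X Y
        by (simp add: S_def algebra_simps)
      moreover have "S X Y \<in> U" for X Y
        using uvw sub by (simp add: S_def subspace_add subspace_scale)
      moreover have "S X x = 0" if "x \<in> U" for X x
        using uvw that by (simp add: S_def iso)
      ultimately have "good S" unfolding good_def fp by blast
      moreover have "cubic_apply (sym_cube_flat \<omega> (sym_prod u v w)) X Y Z = \<omega> (S X Y) Z" for X Y Z
        by (simp add: sym_cube_flat_prod[OF bil] S_def form_simps field_simps)
      ultimately show "sym_prod u v w \<in> D" by (auto simp: D_def)
    qed
  qed
  with T obtain S where S: "good S"
    "\<And>X Y Z. cubic_apply (sym_cube_flat \<omega> T) X Y Z = \<omega> (S X Y) Z"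
    by (auto simp: D_def)
  have "S \<in> commuting_prolongation (sp_algebra \<omega>)"
    using S(1) by (simp add: commuting_prolongation_def good_def)
  moreover have "sym_cube_flat \<omega> T = prolongation_form \<omega> S"
    using S by (simp add: cubic_apply_inject[symmetric] fun_eq_iff good_def
        cubic_apply_prolongation_form[OF symp])
  ultimately show "T \<in> C_sp \<omega>" by (auto simp: C_sp_def)
qed

end

theorem theorem9:
  fixes \<omega> :: "'a::real_vector \<Rightarrow> 'a \<Rightarrow> real"
  assumes "finite_dimensional TYPE('a)" and "symplectic_form \<omega>"
  shows "(\<forall>U. lagrangian \<omega> U \<longrightarrow>
            (\<forall>T\<in>C_sp \<omega>. Sp_orbit \<omega> T \<inter> sym_cube_of U \<noteq> {}))
       \<and> C_sp \<omega> = (\<Union>U\<in>{U. lagrangian \<omega> U}. sym_cube_of U)"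
proof -
  interpret symplectic_space \<omega> by standard (rule assms)+
  have "Sp_orbit \<omega> T \<inter> sym_cube_of U \<noteq> {}" if U: "lagrangian \<omega> U" and T: "T \<in> C_sp \<omega>" for U T
  proof -
    obtain U' where U': "lagrangian \<omega> U'" "T \<in> sym_cube_of U'"
      using C_sp_in_lagrangian_cube[OF T] .
    obtain g where g: "g \<in> Sp_group \<omega>" "g ` U' \<subseteq> U"
      using Sp_transitive_on_lagrangians[OF U'(1) U] .
    then have "sym_cube_action g T \<in> sym_cube_of U"
      using sym_cube_action_sym_cube_of U'(2) by (auto simp: Sp_group_def)
    with g(1) show ?thesis by (auto simp: Sp_orbit_def)
  qed
  moreover have "C_sp \<omega> = (\<Union>U\<in>{U. lagrangian \<omega> U}. sym_cube_of U)"
    using lagrangian_cube_subset_C_sp by (blast elim: C_sp_in_lagrangian_cube)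
  ultimately show ?thesis by blast
qed

end
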